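(* Let $a, b$ be relatively prime positive integers such that $\frac{a}{b} > 1$, and let $w(i)$ be the letter at position $i$ in $\textbf{w}_{a/b}$. Then $w(i) = O(\sqrt{i})$.
   Context: Words are finite or infinite sequences of letters, indexed from position $0$; a factor is a contiguous subword. For relatively prime positive integers $a,b$ and a nonempty word $v$ whose length is divisible by $b$, define $v^{a/b} = v^{\lfloor a/b \rfloor} v_0 v_1 \cdots v_{t-1}$, where $t = |v|\,(a/b - \lfloor a/b\rfloor)$; such a word is called an $\frac{a}{b}$-power. A word is $\frac{a}{b}$-power-free if none of its factors is an $\frac{a}{b}$-power. For $\frac{a}{b} > 1$, $\textbf{w}_{a/b}$ denotes the lexicographically least infinite word over the alphabet $\mathbb{Z}_{\geq 0}$ that is $\frac{a}{b}$-power-free. *)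

theory Defs
  imports
    Complex_Main
    "HOL-Library.Omega_Words_Fun"
    "HOL-Library.Fun_Lexorder"
    "HOL-Library.Landau_Symbols"
begin

text \<open>
  Finite words are lists and infinite words are functions on \<^typ>\<open>nat\<close>
  (\<^typ>\<open>'a word\<close>), both indexed from 0; \<^term>\<open>subsequence w i j\<close> is the word
  \<open>w i, \<dots>, w (j - 1)\<close>, so these are exactly the finite factors of \<^term>\<open>w\<close>.
\<close>

text \<open>
  The word \<open>v^(a/b)\<close>. Since \<open>a/b - \<lfloor>a/b\<rfloor> = (a mod b)/b\<close>, the length
  \<open>t = |v| (a/b - \<lfloor>a/b\<rfloor>)\<close> of the partial copy of \<open>v\<close> is
  \<open>|v| (a mod b) / b\<close>; the division is exact whenever \<open>b\<close> divides \<open>|v|\<close>,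
  the only case in which the definition is used.
\<close>
definition frac_power :: "nat \<Rightarrow> nat \<Rightarrow> 'a list \<Rightarrow> 'a list" where
  "frac_power a b v =
     concat (replicate (a div b) v) @ take (length v * (a mod b) div b) v"

definition is_frac_power :: "nat \<Rightarrow> nat \<Rightarrow> 'a list \<Rightarrow> bool" where
  "is_frac_power a b u \<longleftrightarrow> (\<exists>v. v \<noteq> [] \<and> b dvd length v \<and> u = frac_power a b v)"

definition frac_power_free :: "nat \<Rightarrow> nat \<Rightarrow> 'a word \<Rightarrow> bool" where
  "frac_power_free a b w \<longleftrightarrow> (\<forall>i j. \<not> is_frac_power a b (subsequence w i j))"

text \<open>
  \<^const>\<open>less_fun\<close> is the strict lexicographic order on infinite words. The description
  is meaningful for \<open>a > b > 0\<close>: the last letter of an \<open>a/b\<close>-power also occurs earlier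
  in it, so a power-free prefix can always be extended by a letter not used before.
\<close>
definition lex_least_word :: "nat \<Rightarrow> nat \<Rightarrow> nat word" where
  "lex_least_word a b =
     (THE w. frac_power_free a b w \<and>
       (\<forall>w'. frac_power_free a b w' \<longrightarrow> w' = w \<or> less_fun w w'))"

end

theory Submission
  imports Defs
begin

text \<open>
  The word is built greedily, so each letter \<open>c < w i\<close> is excluded by an \<open>a/b\<close>-power of
  some length \<open>a m\<close> that would end at position \<open>i\<close>; its period is \<open>b m\<close>. If \<open>m < m'\<close>
  belong to two different excluded letters, then the \<open>(a - b) m - 1\<close> letters before
  position \<open>i\<close> reappear before the positions \<open>i - b m\<close> and \<open>i - b m'\<close>. The distance of these
  copies is \<open>b (m' - m)\<close>, so \<open>m' - m < m\<close> would create an \<open>a/b\<close>-power inside \<open>w\<close>. Hence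
  the values of \<open>m\<close> at least double from one to the next, and \<open>2 ^ w i \<le> 2 (i + 1)\<close>, which
  is much stronger than the bound \<open>O(\<surd>i)\<close>.
\<close>

section \<open>Fractional powers as periodic words\<close>

lemma nth_concat_replicate:
  "k < n * length v \<Longrightarrow> concat (replicate n v) ! k = v ! (k mod length v)"
proof (induction n arbitrary: k)
  case (Suc n)
  show ?case
  proof (cases "k < length v")
    case False
    then show ?thesis
      using Suc by (simp add: nth_append le_mod_geq)
  qed (simp add: nth_append)
qed simp

lemma length_concat_replicate: "length (concat (replicate n v)) = n * length v"
  by (induction n) auto

context
  fixes a b :: nat
  assumes b_pos: "0 < b" and b_less_a: "b < a"
begin

lemma length_frac_power:
  assumes "length v = b * m"
  shows "length (frac_power a b v) = a * m"
proof -
  \<comment> \<open>The partial copy is no longer than \<open>v\<close>, so \<open>take\<close>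
    returns its full nominal length.\<close>
  have "a mod b * m \<le> b * m"
    using b_pos by (intro mult_right_mono) (auto simp: less_imp_le)
  moreover have "length v * (a mod b) div b = a mod b * m"
    using assms b_pos by (simp add: mult.assoc mult.commute)
  ultimately have "length (frac_power a b v) = (a div b) * (b * m) + a mod b * m"
    using assms by (simp add: frac_power_def length_concat_replicate)
  also have "\<dots> = (a div b * b + a mod b) * m"
    by (simp only: algebra_simps)
  finally show ?thesis by (simp only: div_mult_mod_eq)
qed

lemma nth_frac_power:
  assumes "length v = b * m" "k < a * m"
  shows "frac_power a b v ! k = v ! (k mod (b * m))"
proof (cases "k < a div b * length v")
  case True
  then show ?thesis
    using assms by (simp add: frac_power_def nth_append length_concat_replicate nth_concat_replicate)
next
  case False
  let ?q = "a div b * length v" and ?t = "length v * (a mod b) div b"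
  have t: "?t = a mod b * m"
    using assms b_pos by (simp add: mult.assoc mult.commute)
  have "a * m = (a div b * b + a mod b) * m" by (simp only: div_mult_mod_eq)
  also have "\<dots> = ?q + ?t" unfolding t by (simp only: assms(1) algebra_simps)
  finally have less_t: "k - ?q < ?t" using False assms by simp
  have m: "0 < m" using assms by (cases m) auto
  have "?t < length v" using t assms b_pos m by simp
  then have less: "k - ?q < length v" using less_t by simp
  have "k = (k - ?q) + ?q" using False by simp
  then have "k mod length v = k - ?q"
    using less by (metis mod_less mod_mult_self3 add.commute)
  then show ?thesis
    using assms False less_t by (simp add: frac_power_def nth_append length_concat_replicate)
qed

text \<open>A word with period \<open>b * m\<close> is determined by its first \<open>b * m\<close>
  letters, so the root \<open>v\<close> can be recovered as that prefix.\<close>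

lemma is_frac_power_iff_periodic:
  "is_frac_power a b u \<longleftrightarrow>
    (\<exists>m>0. length u = a * m \<and> (\<forall>k. k + b * m < a * m \<longrightarrow> u ! (k + b * m) = u ! k))"
    (is "_ \<longleftrightarrow> (\<exists>m>0. ?P m)")
proof
  assume "is_frac_power a b u"
  then obtain v m where v: "v \<noteq> []" "length v = b * m" "u = frac_power a b v"
    by (auto simp: is_frac_power_def dvd_def)
  then have "m > 0" by (cases m) auto
  moreover have "u ! (k + b * m) = u ! k" if "k + b * m < a * m" for k
  proof -
    have "k < a * m" using that by simp
    then show ?thesis
      using that v(3) by (simp add: nth_frac_power[OF v(2)])
  qed
  then have "?P m"
    using v(3) by (simp add: length_frac_power[OF v(2)])
  ultimately show "\<exists>m>0. ?P m" by blast
next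
  assume "\<exists>m>0. ?P m"
  then obtain m where m: "m > 0" "length u = a * m"
    and per: "\<And>k. k + b * m < a * m \<Longrightarrow> u ! (k + b * m) = u ! k"
    by auto
  let ?v = "take (b * m) u"
  have len: "length ?v = b * m" using m b_less_a by simp
  have bm: "0 < b * m" using m b_pos by simp
  have "k < a * m \<longrightarrow> u ! k = u ! (k mod (b * m))" for k
  proof (induction k rule: less_induct)
    case (less k)
    show ?case
    proof (cases "k < b * m")
      case False
      then show ?thesis
        using less[of "k - b * m"] per[of "k - b * m"] bm by (auto simp: le_mod_geq)
    qed simp
  qed
  then have "u = frac_power a b ?v"
    using m b_pos by (intro nth_equalityI)
      (simp_all add: length_frac_power[OF len] nth_frac_power[OF len] del: length_take)
  moreover have "?v \<noteq> []" using len m b_pos by fastforce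
  ultimately show "is_frac_power a b u"
    unfolding is_frac_power_def using len by (metis dvd_triv_left)
qed

section \<open>Powers ending at a given position\<close>

text \<open>Indices run backwards from the last position \<open>e\<close>, so that powers with a
  common end can be compared directly. The condition \<open>a * m \<le> Suc e\<close> keeps the
  natural subtractions from truncating.\<close>

definition power_ends_at :: "nat word \<Rightarrow> nat \<Rightarrow> nat \<Rightarrow> bool" where
  "power_ends_at w e m \<longleftrightarrow>
     0 < m \<and> a * m \<le> Suc e \<and> (\<forall>k<(a - b) * m. w (e - k) = w (e - k - b * m))"

lemma power_ends_at_cong:
  assumes "\<And>j. j \<le> e \<Longrightarrow> w j = w' j"
  shows "power_ends_at w e m \<longleftrightarrow> power_ends_at w' e m"
  using assms unfolding power_ends_at_def by simp

lemma frac_power_free_iff: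
  "frac_power_free a b w \<longleftrightarrow> (\<forall>e m. \<not> power_ends_at w e m)"
proof -
  have "\<exists>e m. power_ends_at w e m" if power: "is_frac_power a b (subsequence w i j)" for i j
  proof -
    obtain m where m: "m > 0" "j - i = a * m"
      and per: "\<And>k. k + b * m < a * m \<Longrightarrow> w (i + (k + b * m)) = w (i + k)"
    proof -
      obtain m where "m > 0" "j - i = a * m"
        and *: "\<And>k. k + b * m < a * m \<Longrightarrow>
          subsequence w i j ! (k + b * m) = subsequence w i j ! k"
        using power unfolding is_frac_power_iff_periodic by (metis subsequence_length)
      moreover have "w (i + (k + b * m)) = w (i + k)" if k: "k + b * m < a * m" for k
      proof -
        have "k + b * m < j - i" "k < j - i" using k \<open>j - i = a * m\<close> by linarith+
        then show ?thesis using *[OF k] by simp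
      qed
      ultimately show thesis using that by blast
    qed
    have am: "0 < a * m" using m b_less_a by simp
    have "w (j - 1 - k) = w (j - 1 - k - b * m)" if "k < (a - b) * m" for k
    proof -
      have k: "k + b * m < a * m" using that by (simp add: diff_mult_distrib)
      \<comment> \<open>\<open>l\<close> is the offset from the start of the factor that matches the
        backward offset \<open>k\<close>.\<close>
      define l where "l = a * m - 1 - b * m - k"
      have l: "l + b * m < a * m" "i + (l + b * m) = j - 1 - k" "i + l = j - 1 - k - b * m"
        using k m am unfolding l_def by linarith+
      show ?thesis using per[OF l(1)] l by simp
    qed
    then have "power_ends_at w (j - 1) m"
      using m am unfolding power_ends_at_def by auto
    then show ?thesis by blast
  qed
  moreover have "\<exists>i j. is_frac_power a b (subsequence w i j)" if "power_ends_at w e m" for e m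
  proof -
    define s where "s = Suc e - a * m"
    have m: "0 < m" "a * m \<le> Suc e"
      and per: "\<And>k. k < (a - b) * m \<Longrightarrow> w (e - k) = w (e - k - b * m)"
      using that by (auto simp: power_ends_at_def)
    have "subsequence w s (Suc e) ! (k + b * m) = subsequence w s (Suc e) ! k"
      if k: "k + b * m < a * m" for k
    proof -
      define l where "l = a * m - 1 - b * m - k"
      have l: "l < (a - b) * m" "s + (k + b * m) = e - l" "s + k = e - l - b * m"
        using k m unfolding l_def s_def diff_mult_distrib by linarith+
      have "k + b * m < Suc e - s" "k < Suc e - s"
        using k m unfolding s_def by linarith+
      then show ?thesis using per[OF l(1)] l by (simp only: subsequence_nth)
    qed
    then have "is_frac_power a b (subsequence w s (Suc e))"
      unfolding is_frac_power_iff_periodic using m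
      by (intro exI[of _ m]) (simp add: s_def)
    then show ?thesis by blast
  qed
  ultimately show ?thesis unfolding frac_power_free_def by blast
qed

section \<open>The greedy word is the lexicographically least one\<close>

text \<open>The guard \<open>j < i\<close> secures termination. Positions after \<open>i\<close>
  also receive \<open>c\<close>, but a power ending at \<open>i\<close> never reads them.\<close>

function greedy_word :: "nat word" where
  "greedy_word i =
     (LEAST c. \<forall>m. \<not> power_ends_at (\<lambda>j. if j < i then greedy_word j else c) i m)"
  by auto
termination by (relation "measure id") auto

declare greedy_word.simps [simp del]

lemma greedy_word_eq:
  "greedy_word i = (LEAST c. \<forall>m. \<not> power_ends_at (greedy_word(i := c)) i m)"
proof -
  have "power_ends_at (\<lambda>j. if j < i then greedy_word j else c) i m \<longleftrightarrow>
      power_ends_at (greedy_word(i := c)) i m" for c m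
    by (rule power_ends_at_cong) auto
  then show ?thesis by (subst greedy_word.simps) simp
qed

lemma power_ends_at_last_letter:
  assumes "power_ends_at w e m"
  shows "w e = w (e - b * m)" "e - b * m < e"
proof -
  have "0 < (a - b) * m" "0 < b * m" and am: "a * m \<le> Suc e"
    using assms b_pos b_less_a by (auto simp: power_ends_at_def)
  then show "w e = w (e - b * m)"
    using assms unfolding power_ends_at_def by (metis diff_zero)
  \<comment> \<open>A power has at least two letters, hence \<open>e > 0\<close>; at
    \<open>e = 0\<close> truncated subtraction would break the strict inequality.\<close>
  have "1 < a" "0 < m" using assms b_pos b_less_a by (auto simp: power_ends_at_def)
  then have "1 < a * m"
    by (metis One_nat_def Suc_leI less_le_trans mult.right_neutral mult_le_mono2)
  then show "e - b * m < e" using \<open>0 < b * m\<close> am by linarith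
qed

text \<open>The last letter of a power occurs earlier in it, which a fresh letter cannot do. This
  ensures that the \<open>LEAST\<close> in the greedy choice is attained.\<close>

lemma no_power_ends_at_new_letter:
  assumes "\<And>j. j < i \<Longrightarrow> w j < c"
  shows "\<not> power_ends_at (w(i := c)) i m"
proof
  assume "power_ends_at (w(i := c)) i m"
  from power_ends_at_last_letter[OF this] assms[of "i - b * m"] show False by simp
qed

lemma greedy_word_free: "frac_power_free a b greedy_word"
  unfolding frac_power_free_iff
proof (intro allI)
  fix e m
  \<comment> \<open>For \<open>e = 0\<close> this is a \<open>Max\<close> of the empty set, but then
    no \<open>j\<close> is constrained.\<close>
  have "greedy_word j < Suc (Max (greedy_word ` {..<e}))" if "j < e" for j
    using that by (auto simp: less_Suc_eq_le)
  then have "\<forall>m. \<not> power_ends_at (greedy_word(e := Suc (Max (greedy_word ` {..<e})))) e m"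
    using no_power_ends_at_new_letter by blast
  from LeastI[of "\<lambda>c. \<forall>m. \<not> power_ends_at (greedy_word(e := c)) e m", OF this]
  show "\<not> power_ends_at greedy_word e m"
    unfolding greedy_word_eq[of e, symmetric] fun_upd_triv by blast
qed

lemma power_ends_at_if_less_greedy_word:
  assumes "c < greedy_word i"
  shows "\<exists>m. power_ends_at (greedy_word(i := c)) i m"
  using not_less_Least[OF assms[unfolded greedy_word_eq[of i]]] by blast

text \<open>At the first difference, a smaller letter in \<open>w\<close> would complete a power,
  since it was rejected by the greedy choice after the same prefix.\<close>

lemma greedy_word_least:
  assumes "frac_power_free a b w" "w \<noteq> greedy_word"
  shows "less_fun greedy_word w"
proof -
  define k where "k = (LEAST k. w k \<noteq> greedy_word k)"
  have k: "w k \<noteq> greedy_word k"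
    unfolding k_def by (rule LeastI_ex) (use assms(2) in auto)
  have eq: "w j = greedy_word j" if "j < k" for j
    using not_less_Least[OF that[unfolded k_def]] by blast
  have "\<not> w k < greedy_word k"
  proof
    assume "w k < greedy_word k"
    then obtain m where "power_ends_at (greedy_word(k := w k)) k m"
      using power_ends_at_if_less_greedy_word by blast
    moreover have "power_ends_at (greedy_word(k := w k)) k m \<longleftrightarrow> power_ends_at w k m"
      using eq by (intro power_ends_at_cong) auto
    ultimately show False using assms(1) by (simp add: frac_power_free_iff)
  qed
  then have "greedy_word k < w k" using k by simp
  then show ?thesis using eq by (auto simp: less_fun_def)
qed

lemma lex_least_word_eq_greedy_word: "lex_least_word a b = greedy_word"
  unfolding lex_least_word_def
proof (rule the_equality)
  show "frac_power_free a b greedy_word \<and>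
      (\<forall>w'. frac_power_free a b w' \<longrightarrow> w' = greedy_word \<or> less_fun greedy_word w')"
    using greedy_word_free greedy_word_least by blast
next
  fix w :: "nat word"
  assume "frac_power_free a b w \<and>
    (\<forall>w'. frac_power_free a b w' \<longrightarrow> w' = w \<or> less_fun w w')"
  then show "w = greedy_word"
    using greedy_word_free greedy_word_least less_fun_asym by blast
qed

section \<open>Doubling of the excluding powers\<close>

lemma excluding_powers_double:
  assumes free: "frac_power_free a b w"
    and P: "power_ends_at (w(i := c)) i m" and P': "power_ends_at (w(i := c')) i m'"
    and less: "m < m'"
  shows "2 * m \<le> m'"
proof (rule ccontr)
  assume "\<not> 2 * m \<le> m'"
  define d where "d = m' - m"
  have d: "0 < d" "d < m" "m' = m + d"
    using less \<open>\<not> 2 * m \<le> m'\<close> by (auto simp: d_def)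
  have i: "0 < i" using power_ends_at_last_letter(2)[OF P] by simp
  obtain n where n: "a = b + n" "0 < n"
    using b_less_a less_imp_add_positive by blast
  then have "a - b = n" by simp
  have "a * m' \<le> Suc i" using P' by (simp add: power_ends_at_def)
  then have len: "b * m + n * m + b * d + n * d \<le> Suc i"
    unfolding d(3) n(1) by (simp add: algebra_simps)
  have "n * d < n * m" using d n by simp
  \<comment> \<open>The new power ends just before \<open>i - b * m\<close>: position
    \<open>i\<close> itself is avoided because the two hypotheses put possibly different letters
    there. The loss of one letter is affordable because \<open>n * d < n * m\<close>.\<close>
  have "power_ends_at w (i - b * m - 1) d"
    unfolding power_ends_at_def
  proof (intro conjI allI impI)
    show "0 < d" by fact
    have "a * d = b * d + n * d" by (simp add: n algebra_simps)
    then show "a * d \<le> Suc (i - b * m - 1)" using len d n by (cases "n * m") auto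
  next
    fix k assume "k < (a - b) * d"
    then have k: "k < n * d" using n by simp
    have per: "\<And>l. l < n * m \<Longrightarrow> (w(i := c)) (i - l) = (w(i := c)) (i - l - b * m)"
      and per': "\<And>l. l < n * m' \<Longrightarrow> (w(i := c')) (i - l) = (w(i := c')) (i - l - b * m')"
      using P P' \<open>a - b = n\<close> by (auto simp only: power_ends_at_def)
    have "Suc k < n * m" using k \<open>n * d < n * m\<close> by linarith
    then have "Suc k < n * m'" unfolding d(3) by (simp add: distrib_left trans_less_add1)
    have *: "i - Suc k \<noteq> i" "i - Suc k - b * m \<noteq> i" "i - Suc k - b * m' \<noteq> i"
      using i by linarith+
    have "w (i - Suc k - b * m) = w (i - Suc k)"
      using per[OF \<open>Suc k < n * m\<close>] * by simp
    also have "\<dots> = w (i - Suc k - b * m')"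
      using per'[OF \<open>Suc k < n * m'\<close>] * by simp
    finally have "w (i - Suc k - b * m) = w (i - Suc k - b * m')" .
    moreover have "i - Suc k - b * m = i - b * m - 1 - k" by simp
    moreover have "i - Suc k - b * m' = i - b * m - 1 - k - b * d"
      unfolding d(3) by (simp add: distrib_left)
    ultimately show "w (i - b * m - 1 - k) = w (i - b * m - 1 - k - b * d)" by metis
  qed
  then show False using free by (simp add: frac_power_free_iff)
qed

end

section \<open>Counting and the growth bound\<close>

text \<open>Induction on the maximum \<open>x\<close>: the other elements lie in
  \<open>{1..x div 2}\<close>, so their count \<open>n\<close> satisfies
  \<open>2 ^ n \<le> x\<close>, and adding \<open>x\<close> doubles the left side.\<close>

lemma power_card_le_if_doubling:
  fixes M :: "nat set"
  assumes "finite M" "M \<subseteq> {1..N}" "0 < N" "\<And>x y. x \<in> M \<Longrightarrow> y \<in> M \<Longrightarrow> x < y \<Longrightarrow> 2 * x \<le> y"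
  shows "2 ^ card M \<le> 2 * N"
  using assms
proof (induction M arbitrary: N rule: finite_linorder_max_induct)
  case (insert x A)
  show ?case
  proof (cases "A = {}")
    case False
    have double: "2 * y \<le> x" if "y \<in> A" for y
      using insert.hyps(2) insert.prems(3)[of y x] that by blast
    then have sub: "A \<subseteq> {1..x div 2}" using insert.prems(1) by force
    moreover have "0 < x div 2" using sub False by fastforce
    ultimately have "2 ^ card A \<le> 2 * (x div 2)"
      using insert.prems(3) by (intro insert.IH) auto
    then have "2 ^ card A \<le> x" by linarith
    moreover have "x \<notin> A" "x \<le> N" using insert.hyps(2) insert.prems(1) by auto
    ultimately show ?thesis using insert.hyps(1) by simp
  qed (use insert.prems in simp)
qed simp

text \<open>The linear terms make the induction go through from \<open>n = 0\<close>.\<close>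
lemma square_le_power_two: "n ^ 2 + 2 * n + 3 \<le> 3 * 2 ^ n" for n :: nat
proof (induction n)
  case (Suc n)
  have "Suc n ^ 2 + 2 * Suc n + 3 \<le> 2 * (n ^ 2 + 2 * n + 3)"
    by (simp add: power2_eq_square)
  also have "\<dots> \<le> 3 * 2 ^ Suc n" using Suc by simp
  finally show ?case .
qed simp

lemma power_lex_least_word_le:
  assumes "0 < b" "b < a"
  shows "2 ^ lex_least_word a b i \<le> 2 * Suc i"
proof -
  define w where "w = lex_least_word a b"
  note w_eq = lex_least_word_eq_greedy_word[OF assms, folded w_def]
  have free: "frac_power_free a b w"
    using greedy_word_free[OF assms] w_eq by simp
  have "\<exists>m. power_ends_at a b (w(i := c)) i m" if "c < w i" for c
    using power_ends_at_if_less_greedy_word[OF assms] w_eq that by simp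
  then obtain f where f: "\<And>c. c < w i \<Longrightarrow> power_ends_at a b (w(i := c)) i (f c)"
    by metis
  \<comment> \<open>The source position precedes \<open>i\<close>, so the update does not affect it.
    Thus \<open>f c\<close> determines \<open>c\<close>, which makes \<open>f\<close>
    injective.\<close>
  have letter: "c = w (i - b * f c)" if "c < w i" for c
    using power_ends_at_last_letter[OF assms f[OF that]] by simp
  have "inj_on f {..<w i}"
    using letter by (intro inj_onI) (metis lessThan_iff)
  then have card: "card (f ` {..<w i}) = w i" by (simp add: card_image)
  have "f c \<in> {1..Suc i}" if "c < w i" for c
  proof -
    have "0 < f c" "a * f c \<le> Suc i"
      using f[OF that] by (auto simp: power_ends_at_def[OF assms])
    moreover have "1 * f c \<le> a * f c" using assms by (intro mult_right_mono) auto
    ultimately have "f c \<le> Suc i" by linarith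
    then show ?thesis using \<open>0 < f c\<close> by simp
  qed
  moreover have "2 * f c \<le> f c'" if "c < w i" "c' < w i" "f c < f c'" for c c'
    using excluding_powers_double[OF assms free f f] that by blast
  ultimately have "2 ^ card (f ` {..<w i}) \<le> 2 * Suc i"
    by (intro power_card_le_if_doubling) auto
  then show ?thesis unfolding card unfolding w_def .
qed

theorem theorem2p9:
  fixes a b :: nat
  assumes "a > 0" and "b > 0" and "coprime a b" and "real a / real b > 1"
  shows "(\<lambda>i. real (lex_least_word a b i)) \<in> O(\<lambda>i. sqrt (real i))"
proof (rule bigoI)
  have "b < a" using assms by (simp add: field_simps)
  \<comment> \<open>The constant comes from \<open>3 * (2 * Suc i) \<le> 12 * i\<close>, valid once
    \<open>1 \<le> i\<close>.\<close>
  have "real (lex_least_word a b i) \<le> sqrt 12 * sqrt (real i)" if "1 \<le> i" for i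
  proof -
    let ?n = "lex_least_word a b i"
    have "?n ^ 2 \<le> 3 * 2 ^ ?n" using square_le_power_two[of ?n] by simp
    also have "\<dots> \<le> 12 * i"
      using power_lex_least_word_le[OF \<open>b > 0\<close> \<open>b < a\<close>, of i] that by simp
    finally have "real (?n ^ 2) \<le> real (12 * i)" by (simp only: of_nat_le_iff)
    then have "real ?n \<le> sqrt (12 * real i)" by (intro real_le_rsqrt) simp
    then show ?thesis by (simp add: real_sqrt_mult)
  qed
  then show "\<forall>\<^sub>F i in sequentially.
      norm (real (lex_least_word a b i)) \<le> sqrt 12 * norm (sqrt (real i))"
    by (auto simp: eventually_sequentially)
qed

end
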